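(* Let $(X,T)$ be a transitive topological dynamical system. (1) The set of weakly mean equicontinuous points of $(X,T)$ is either empty or residual. If in addition $(X,T)$ is almost weakly mean equicontinuous, then every transitive point is weakly mean equicontinuous. (2) If $(X,T)$ is minimal and almost weakly mean equicontinuous, then it is weakly mean equicontinuous.
   Context: A topological dynamical system $(X,T)$ consists of a nonempty compact metric space $X$ with metric $d$ and a continuous map $T:X\to X$. A point is a transitive point if its forward orbit $\{x,Tx,T^2x,\dots\}$ is dense in $X$. $(X,T)$ is transitive if it has a transitive point; here it is understood, as a standing convention, that in a transitive system the set of transitive points is a dense $G_\delta$ subset of $X$. $(X,T)$ is minimal if every point is a transitive point. $S_n$ denotes the group of permutations of $\{1,\dots,n\}$. For $x,y\in X$ put $\overline{F}(x,y)=\limsup_{n\to\infty}\inf_{\sigma\in S_n}\frac1n\sum_{k=1}^n d(T^kx,T^{\sigma(k)}y)$. A point $x$ is weakly mean equicontinuous if for every $\varepsilon>0$ there is $\delta>0$ such that $\overline{F}(x,y)<\varepsilon$ for every $y$ with $d(x,y)<\delta$. $(X,T)$ is weakly mean equicontinuous if for every $\varepsilon>0$ there is $\delta>0$ such that $d(x,y)<\delta$ implies $\overline{F}(x,y)<\varepsilon$. $(X,T)$ is almost weakly mean equicontinuous if it is transitive and has at least one weakly mean equicontinuous point. A set is residual if it contains a countable intersection of dense open sets. *)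

theory Defs
  imports "HOL-Analysis.Analysis"
begin

text \<open>
  A compact metric space is rendered as a compact subset \<open>X\<close> of a type of class
  \<open>metric_space\<close>; \<open>T\<close> is only relevant on \<open>X\<close>, and density, openness and the
  \<open>G\<^sub>\<delta>\<close> property are always relative to \<open>X\<close>.
\<close>

definition tds :: "'a::metric_space set \<Rightarrow> ('a \<Rightarrow> 'a) \<Rightarrow> bool" where
  "tds X T \<longleftrightarrow> X \<noteq> {} \<and> compact X \<and> continuous_on X T \<and> T ` X \<subseteq> X"

definition dense_subset :: "'a::topological_space set \<Rightarrow> 'a set \<Rightarrow> bool" where
  "dense_subset X A \<longleftrightarrow> A \<subseteq> X \<and> X \<subseteq> closure A"

definition residual_subset :: "'a::topological_space set \<Rightarrow> 'a set \<Rightarrow> bool" where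
  "residual_subset X A \<longleftrightarrow> A \<subseteq> X \<and>
     (\<exists>U :: nat \<Rightarrow> 'a set.
        (\<forall>n. openin (top_of_set X) (U n) \<and> dense_subset X (U n)) \<and> (\<Inter>n. U n) \<subseteq> A)"

definition transitive_points :: "'a::metric_space set \<Rightarrow> ('a \<Rightarrow> 'a) \<Rightarrow> 'a set" where
  "transitive_points X T = {x \<in> X. dense_subset X (range (\<lambda>n. (T ^^ n) x))}"

text \<open>
  The usual convention is built in: in a transitive system the transitive points form a dense
  \<open>G\<^sub>\<delta>\<close> set. A transitive point alone does not give density when \<open>X\<close> has isolated points:
  on \<open>{0} \<union> {1/n | n \<ge> 1}\<close> with \<open>0 \<mapsto> 0\<close> and \<open>1/n \<mapsto> 1/(n+1)\<close> the only transitive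
  point is \<open>1\<close>.
\<close>

definition transitive_tds :: "'a::metric_space set \<Rightarrow> ('a \<Rightarrow> 'a) \<Rightarrow> bool" where
  "transitive_tds X T \<longleftrightarrow> tds X T \<and> transitive_points X T \<noteq> {} \<and>
     gdelta_in (top_of_set X) (transitive_points X T) \<and> dense_subset X (transitive_points X T)"

definition minimal_tds :: "'a::metric_space set \<Rightarrow> ('a \<Rightarrow> 'a) \<Rightarrow> bool" where
  "minimal_tds X T \<longleftrightarrow> tds X T \<and> (\<forall>x\<in>X. x \<in> transitive_points X T)"

text \<open>
  The value is taken in \<^typ>\<open>ereal\<close> because \<^const>\<open>limsup\<close> needs a complete lattice; on a
  compact \<open>X\<close> it is finite. The (junk) term at \<open>n = 0\<close> does not affect the limit superior.
\<close>

definition Fbar :: "('a::metric_space \<Rightarrow> 'a) \<Rightarrow> 'a \<Rightarrow> 'a \<Rightarrow> ereal" where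
  "Fbar T x y = limsup (\<lambda>n::nat. INF \<sigma>\<in>{\<sigma>. \<sigma> permutes {1..n}}.
     ereal (1 / real n * (\<Sum>k=1..n. dist ((T ^^ k) x) ((T ^^ \<sigma> k) y))))"

definition wme_points :: "'a::metric_space set \<Rightarrow> ('a \<Rightarrow> 'a) \<Rightarrow> 'a set" where
  "wme_points X T = {x \<in> X. \<forall>\<epsilon>>0. \<exists>\<delta>>0. \<forall>y\<in>X. dist x y < \<delta> \<longrightarrow> Fbar T x y < ereal \<epsilon>}"

definition weakly_mean_equicontinuous :: "'a::metric_space set \<Rightarrow> ('a \<Rightarrow> 'a) \<Rightarrow> bool" where
  "weakly_mean_equicontinuous X T \<longleftrightarrow> tds X T \<and>
     (\<forall>\<epsilon>>0. \<exists>\<delta>>0. \<forall>x\<in>X. \<forall>y\<in>X. dist x y < \<delta> \<longrightarrow> Fbar T x y < ereal \<epsilon>)"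

definition almost_weakly_mean_equicontinuous ::
    "'a::metric_space set \<Rightarrow> ('a \<Rightarrow> 'a) \<Rightarrow> bool" where
  "almost_weakly_mean_equicontinuous X T \<longleftrightarrow> transitive_tds X T \<and> wme_points X T \<noteq> {}"

end

theory Submission
  imports Defs
begin

text \<open>
  The proof rests on two properties of \<^const>\<open>Fbar\<close>. It is a pseudometric, because an optimal
  matching of \<open>x\<close> with \<open>y\<close> can be composed with one of \<open>y\<close> with \<open>z\<close>; and it does not see
  where an orbit starts, because matching \<open>T(T\<^sup>k x)\<close> with \<open>T\<^sup>k\<^sup>+\<^sup>1 x\<close> by a cyclic shift leaves a
  single nonzero distance, so that \<open>Fbar(T x, x) = 0\<close>. No such invariance under moving only
  one of the two points holds for the ordinary mean pseudometric; here it makes \<^const>\<open>Fbar\<close>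
  depend only on the orbits.

  Let \<open>G\<^sub>\<epsilon>\<close> be the set of points with a neighbourhood of \<open>Fbar\<close>-diameter at most \<open>\<epsilon>\<close>
  (\<open>Fbar_small_points\<close>). By the triangle inequality the weakly mean equicontinuous points are
  exactly those in all \<open>G\<^sub>\<epsilon>\<close>. Each \<open>G\<^sub>\<epsilon>\<close> is open, and by continuity of \<open>T\<^sup>m\<close> and invariance of
  \<^const>\<open>Fbar\<close> it contains every point of \<open>X\<close> whose orbit enters it. If some point is weakly mean
  equicontinuous, every \<open>G\<^sub>\<epsilon>\<close> is nonempty, hence met by every dense orbit, hence contains all
  transitive points. So all transitive points are weakly mean equicontinuous, and since they
  are dense each \<open>G\<^sub>\<epsilon>\<close> is open and dense. In the minimal case every \<open>G\<^sub>\<epsilon>\<close> is the whole space, and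
  a Lebesgue number of the resulting cover gives a uniform \<open>\<delta>\<close>.
\<close>

section \<open>The optimal matching cost\<close>

definition matching_cost :: "('a::metric_space \<Rightarrow> 'a) \<Rightarrow> nat \<Rightarrow> 'a \<Rightarrow> 'a \<Rightarrow> (nat \<Rightarrow> nat) \<Rightarrow> real" where
  "matching_cost T n x y \<sigma> = 1 / real n * (\<Sum>k=1..n. dist ((T ^^ k) x) ((T ^^ \<sigma> k) y))"

definition min_matching_cost :: "('a::metric_space \<Rightarrow> 'a) \<Rightarrow> 'a \<Rightarrow> 'a \<Rightarrow> nat \<Rightarrow> ereal" where
  "min_matching_cost T x y n = (INF \<sigma>\<in>{\<sigma>. \<sigma> permutes {1..n}}. ereal (matching_cost T n x y \<sigma>))"

lemma Fbar_eq_limsup: "Fbar T x y = limsup (min_matching_cost T x y)"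
  by (simp add: Fbar_def min_matching_cost_def[abs_def] matching_cost_def)

lemma min_matching_cost_le:
  "\<sigma> permutes {1..n} \<Longrightarrow> min_matching_cost T x y n \<le> ereal (matching_cost T n x y \<sigma>)"
  unfolding min_matching_cost_def by (rule INF_lower) simp

lemma min_matching_cost_attained:
  obtains \<sigma> where "\<sigma> permutes {1..n}"
    and "min_matching_cost T x y n = ereal (matching_cost T n x y \<sigma>)"
proof -
  let ?C = "(\<lambda>\<sigma>. ereal (matching_cost T n x y \<sigma>)) ` {\<sigma>. \<sigma> permutes {1..n}}"
  have "finite ?C"
    by (simp add: finite_permutations)
  moreover have "?C \<noteq> {}"
    using permutes_id by blast
  ultimately have "Inf ?C \<in> ?C"
    using Min_Inf[of ?C] Min_in[of ?C] by simp
  then show thesis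
    using that unfolding min_matching_cost_def by auto
qed

lemma matching_cost_inv:
  assumes "\<sigma> permutes {1..n}"
  shows "matching_cost T n y x (inv \<sigma>) = matching_cost T n x y \<sigma>"
  using sum.permutes_inv[OF assms, of "\<lambda>i j. dist ((T ^^ j) x) ((T ^^ i) y)"]
  by (simp add: matching_cost_def dist_commute)

lemma matching_cost_compose:
  assumes "\<sigma> permutes {1..n}"
  shows "matching_cost T n x z (\<tau> \<circ> \<sigma>) \<le> matching_cost T n x y \<sigma> + matching_cost T n y z \<tau>"
proof -
  have "(\<Sum>k=1..n. dist ((T ^^ k) x) ((T ^^ \<tau> (\<sigma> k)) z))
      \<le> (\<Sum>k=1..n. dist ((T ^^ k) x) ((T ^^ \<sigma> k) y)
                  + dist ((T ^^ \<sigma> k) y) ((T ^^ \<tau> (\<sigma> k)) z))"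
    by (intro sum_mono dist_triangle)
  also have "\<dots> = (\<Sum>k=1..n. dist ((T ^^ k) x) ((T ^^ \<sigma> k) y))
                + (\<Sum>k=1..n. dist ((T ^^ k) y) ((T ^^ \<tau> k) z))"
    using sum.permute[OF assms, of "\<lambda>k. dist ((T ^^ k) y) ((T ^^ \<tau> k) z)"]
    by (simp add: sum.distrib o_def)
  finally show ?thesis
    by (simp add: matching_cost_def divide_right_mono flip: add_divide_distrib)
qed

section \<open>The limit superior as an orbit-invariant pseudometric\<close>

lemma Fbar_commute: "Fbar T x y = Fbar T y x"
proof -
  have "min_matching_cost T x y n \<le> min_matching_cost T y x n" for x y n
  proof -
    obtain \<sigma> where \<sigma>: "\<sigma> permutes {1..n}"
      "min_matching_cost T y x n = ereal (matching_cost T n y x \<sigma>)"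
      by (rule min_matching_cost_attained)
    show ?thesis
      using min_matching_cost_le[OF permutes_inv[OF \<sigma>(1)], of T x y]
      by (simp add: \<sigma>(2) matching_cost_inv[OF \<sigma>(1)])
  qed
  then have "min_matching_cost T x y = min_matching_cost T y x"
    by (intro ext antisym)
  then show ?thesis
    by (simp add: Fbar_eq_limsup)
qed

lemma Fbar_triangle: "Fbar T x z \<le> Fbar T x y + Fbar T y z"
proof -
  have "min_matching_cost T x z n \<le> min_matching_cost T x y n + min_matching_cost T y z n" for n
  proof -
    obtain \<sigma> where \<sigma>: "\<sigma> permutes {1..n}"
      "min_matching_cost T x y n = ereal (matching_cost T n x y \<sigma>)"
      by (rule min_matching_cost_attained)
    obtain \<tau> where \<tau>: "\<tau> permutes {1..n}"
      "min_matching_cost T y z n = ereal (matching_cost T n y z \<tau>)"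
      by (rule min_matching_cost_attained)
    have "min_matching_cost T x z n \<le> ereal (matching_cost T n x z (\<tau> \<circ> \<sigma>))"
      by (intro min_matching_cost_le permutes_compose \<sigma> \<tau>)
    also have "\<dots> \<le> ereal (matching_cost T n x y \<sigma> + matching_cost T n y z \<tau>)"
      using matching_cost_compose[OF \<sigma>(1)] by simp
    finally show ?thesis
      by (simp add: \<sigma> \<tau>)
  qed
  then have "limsup (min_matching_cost T x z)
      \<le> limsup (\<lambda>n. min_matching_cost T x y n + min_matching_cost T y z n)"
    by (intro Limsup_mono always_eventually allI)
  also have "\<dots> \<le> limsup (min_matching_cost T x y) + limsup (min_matching_cost T y z)"
    by (rule ereal_limsup_add_mono)
  finally show ?thesis
    by (simp add: Fbar_eq_limsup)
qed

lemma cyclic_shift_permutes: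
  "(\<lambda>k. if k \<in> {1..n} then if k = n then 1 else Suc k else k) permutes {1..n::nat}"
  (is "?c permutes _")
proof (rule bij_imp_permutes)
  have "inj_on ?c {1..n}"
    by (auto simp: inj_on_def split: if_splits)
  moreover have "?c ` {1..n} \<subseteq> {1..n}"
    by auto
  ultimately show "bij_betw ?c {1..n} {1..n}"
    unfolding bij_betw_def using endo_inj_surj[of "{1..n}" ?c] by blast
qed auto

lemma funpow_in_tds:
  assumes "tds X T" "x \<in> X"
  shows "(T ^^ m) x \<in> X"
  using assms by (induction m) (auto simp: tds_def)

lemma continuous_on_funpow_tds:
  assumes "tds X T"
  shows "continuous_on X (T ^^ m)"
proof (induction m)
  case 0
  show ?case
    by (simp add: id_def[symmetric] continuous_on_id')
next
  case (Suc m)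
  have "(T ^^ m) ` X \<subseteq> X"
    using funpow_in_tds[OF assms] by auto
  moreover have "continuous_on X T"
    using assms by (simp add: tds_def)
  ultimately have "continuous_on X (T \<circ> (T ^^ m))"
    using continuous_on_compose[OF Suc] continuous_on_subset by blast
  then show ?case
    by simp
qed

text \<open>
  Under the cyclic shift only the last point \<open>T\<^sup>n\<^sup>+\<^sup>1 x\<close> is matched with a different point, at
  distance at most the diameter of \<open>X\<close>; dividing by \<open>n\<close>, its contribution vanishes in the limit.
\<close>

lemma Fbar_step_le_0:
  assumes "tds X T" "x \<in> X"
  shows "Fbar T (T x) x \<le> 0"
proof -
  have le: "min_matching_cost T (T x) x n \<le> ereal (diameter X / real n)" for n
  proof -
    let ?c = "\<lambda>k. if k \<in> {1..n} then if k = n then 1 else Suc k else k"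
    have "(\<Sum>k=1..n. dist ((T ^^ k) (T x)) ((T ^^ ?c k) x))
        \<le> (\<Sum>k=1..n. if k = n then diameter X else 0)"
    proof (rule sum_mono)
      fix k assume "k \<in> {1..n}"
      have "dist ((T ^^ k) (T x)) (T x) \<le> diameter X"
        using assms funpow_in_tds[OF assms, of "Suc k"] funpow_in_tds[OF assms, of 1]
        by (intro diameter_bounded_bound)
          (auto simp: tds_def compact_imp_bounded funpow_swap1)
      with \<open>k \<in> {1..n}\<close>
      show "dist ((T ^^ k) (T x)) ((T ^^ ?c k) x) \<le> (if k = n then diameter X else 0)"
        by (auto simp: funpow_swap1)
    qed
    also have "\<dots> \<le> diameter X"
      using assms by (auto simp: tds_def diameter_ge_0 compact_imp_bounded)
    finally have "matching_cost T n (T x) x ?c \<le> diameter X / real n"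
      by (simp add: matching_cost_def divide_right_mono)
    then show ?thesis
      using min_matching_cost_le[OF cyclic_shift_permutes, of T "T x" x n]
      by (meson order_trans ereal_less_eq(3))
  qed
  have "(\<lambda>n. ereal (diameter X / real n)) \<longlonglongrightarrow> ereal 0"
    by (intro tendsto_ereal lim_const_over_n)
  then have "limsup (\<lambda>n. ereal (diameter X / real n)) = 0"
    by (simp add: lim_imp_Limsup zero_ereal_def)
  moreover have "limsup (min_matching_cost T (T x) x) \<le> limsup (\<lambda>n. ereal (diameter X / real n))"
    using le by (intro Limsup_mono always_eventually allI)
  ultimately show ?thesis
    by (simp add: Fbar_eq_limsup)
qed

lemma Fbar_self_le_0: "Fbar T x x \<le> 0"
proof -
  have "min_matching_cost T x x n \<le> 0" for n
    using min_matching_cost_le[OF permutes_id, of T x x n]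
    by (simp add: matching_cost_def zero_ereal_def)
  then have "limsup (min_matching_cost T x x) \<le> limsup (\<lambda>n. 0)"
    by (intro Limsup_mono always_eventually allI)
  then show ?thesis
    by (simp add: Fbar_eq_limsup Limsup_const)
qed

lemma Fbar_funpow_le_0:
  assumes "tds X T" "x \<in> X"
  shows "Fbar T ((T ^^ m) x) x \<le> 0"
proof (induction m)
  case 0
  show ?case
    by (simp add: Fbar_self_le_0)
next
  case (Suc m)
  have "Fbar T ((T ^^ Suc m) x) x \<le> Fbar T (T ((T ^^ m) x)) ((T ^^ m) x) + Fbar T ((T ^^ m) x) x"
    using Fbar_triangle by simp
  also have "\<dots> \<le> 0 + 0"
    by (intro add_mono Suc Fbar_step_le_0[OF assms(1)] funpow_in_tds[OF assms])
  finally show ?case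
    by simp
qed

lemma Fbar_le_Fbar_funpow:
  assumes "tds X T" "x \<in> X" "y \<in> X"
  shows "Fbar T x y \<le> Fbar T ((T ^^ m) x) ((T ^^ m) y)"
proof -
  have "Fbar T x y \<le> Fbar T x ((T ^^ m) x) + Fbar T ((T ^^ m) x) y"
    by (rule Fbar_triangle)
  also have "\<dots> \<le> Fbar T x ((T ^^ m) x)
      + (Fbar T ((T ^^ m) x) ((T ^^ m) y) + Fbar T ((T ^^ m) y) y)"
    by (intro add_left_mono Fbar_triangle)
  also have "\<dots> \<le> 0 + (Fbar T ((T ^^ m) x) ((T ^^ m) y) + 0)"
    using assms by (intro add_mono order_refl) (simp_all add: Fbar_commute[of T x] Fbar_funpow_le_0)
  finally show ?thesis
    by simp
qed

section \<open>Points with neighbourhoods of small diameter\<close>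

definition Fbar_small_points :: "'a::metric_space set \<Rightarrow> ('a \<Rightarrow> 'a) \<Rightarrow> real \<Rightarrow> 'a set" where
  "Fbar_small_points X T \<epsilon> =
     {x \<in> X. \<exists>W. open W \<and> x \<in> W \<and> (\<forall>y\<in>X \<inter> W. \<forall>z\<in>X \<inter> W. Fbar T y z < ereal \<epsilon>)}"

lemma openin_Fbar_small_points: "openin (top_of_set X) (Fbar_small_points X T \<epsilon>)"
proof (subst openin_subopen, intro ballI)
  fix x assume "x \<in> Fbar_small_points X T \<epsilon>"
  then obtain W where W: "x \<in> X" "open W" "x \<in> W"
    "\<forall>y\<in>X \<inter> W. \<forall>z\<in>X \<inter> W. Fbar T y z < ereal \<epsilon>"
    by (auto simp: Fbar_small_points_def)
  then have "X \<inter> W \<subseteq> Fbar_small_points X T \<epsilon>"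
    by (auto simp: Fbar_small_points_def)
  with W show "\<exists>U. openin (top_of_set X) U \<and> x \<in> U \<and> U \<subseteq> Fbar_small_points X T \<epsilon>"
    by (intro exI[of _ "X \<inter> W"]) (auto simp: openin_open_Int)
qed

lemma wme_points_subset_Fbar_small_points:
  assumes "\<epsilon> > 0"
  shows "wme_points X T \<subseteq> Fbar_small_points X T \<epsilon>"
proof
  fix x assume "x \<in> wme_points X T"
  then have x: "x \<in> X" and "\<exists>\<delta>>0. \<forall>y\<in>X. dist x y < \<delta> \<longrightarrow> Fbar T x y < ereal (\<epsilon> / 2)"
    using half_gt_zero[OF assms] unfolding wme_points_def by blast+
  then obtain \<delta> where \<delta>: "\<delta> > 0" "\<And>y. y \<in> X \<Longrightarrow> dist x y < \<delta> \<Longrightarrow> Fbar T x y < ereal (\<epsilon> / 2)"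
    by blast
  have "Fbar T y z < ereal \<epsilon>" if "y \<in> X \<inter> ball x \<delta>" "z \<in> X \<inter> ball x \<delta>" for y z
  proof -
    have "Fbar T y z \<le> Fbar T x y + Fbar T x z"
      using Fbar_triangle[of T y z x] by (simp add: Fbar_commute)
    also have "\<dots> < ereal (\<epsilon> / 2) + ereal (\<epsilon> / 2)"
      using that by (intro ereal_add_strict_mono2 \<delta>) auto
    finally show ?thesis
      by simp
  qed
  with x \<delta>(1) show "x \<in> Fbar_small_points X T \<epsilon>"
    unfolding Fbar_small_points_def by (auto intro!: exI[of _ "ball x \<delta>"])
qed

text \<open>
  Countably many \<open>\<epsilon>\<close> suffice, as residuality requires.
\<close>

lemma INT_Fbar_small_points_subset_wme_points:
  "(\<Inter>n. Fbar_small_points X T (1 / real (Suc n))) \<subseteq> wme_points X T"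
proof
  fix x assume x: "x \<in> (\<Inter>n. Fbar_small_points X T (1 / real (Suc n)))"
  have "\<exists>\<delta>>0. \<forall>y\<in>X. dist x y < \<delta> \<longrightarrow> Fbar T x y < ereal \<epsilon>" if "\<epsilon> > 0" for \<epsilon>
  proof -
    obtain n where n: "1 / real (Suc n) < \<epsilon>"
      using \<open>\<epsilon> > 0\<close> by (rule nat_approx_posE)
    from x have "x \<in> Fbar_small_points X T (1 / real (Suc n))"
      by blast
    then obtain W where W: "x \<in> X" "open W" "x \<in> W"
      "\<forall>y\<in>X \<inter> W. \<forall>z\<in>X \<inter> W. Fbar T y z < ereal (1 / real (Suc n))"
      unfolding Fbar_small_points_def by blast
    obtain \<delta> where "\<delta> > 0" "ball x \<delta> \<subseteq> W"
      using W open_contains_ball by blast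
    moreover from this have "Fbar T x y < ereal \<epsilon>" if "y \<in> X" "dist x y < \<delta>" for y
    proof -
      have "y \<in> X \<inter> W"
        using that \<open>ball x \<delta> \<subseteq> W\<close> by auto
      with W have "Fbar T x y < ereal (1 / real (Suc n))"
        by blast
      also have "\<dots> < ereal \<epsilon>"
        using n by simp
      finally show ?thesis .
    qed
    ultimately show ?thesis
      by blast
  qed
  moreover have "x \<in> X"
    using x by (auto simp: Fbar_small_points_def)
  ultimately show "x \<in> wme_points X T"
    by (simp add: wme_points_def)
qed

text \<open>
  Pulling a neighbourhood of \<open>T\<^sup>m x\<close> back along \<open>T\<^sup>m\<close> does not increase its \<^const>\<open>Fbar\<close>-diameter.
\<close>

lemma Fbar_small_points_backward:
  assumes tds: "tds X T" and "x \<in> X" and "(T ^^ m) x \<in> Fbar_small_points X T \<epsilon>"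
  shows "x \<in> Fbar_small_points X T \<epsilon>"
proof -
  obtain W where W: "open W" "(T ^^ m) x \<in> W"
    "\<forall>y\<in>X \<inter> W. \<forall>z\<in>X \<inter> W. Fbar T y z < ereal \<epsilon>"
    using assms by (auto simp: Fbar_small_points_def)
  obtain V where V: "open V" "V \<inter> X = (T ^^ m) -` W \<inter> X"
    using continuous_on_funpow_tds[OF tds, of m] W(1) unfolding continuous_on_open_invariant by blast
  have "Fbar T y z < ereal \<epsilon>" if "y \<in> X \<inter> V" "z \<in> X \<inter> V" for y z
  proof -
    have "(T ^^ m) y \<in> X \<inter> W" "(T ^^ m) z \<in> X \<inter> W"
      using that V(2) funpow_in_tds[OF tds] by auto
    then show ?thesis
      using W(3) Fbar_le_Fbar_funpow[OF tds, of y z m] that by (meson IntD1 order_le_less_trans)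
  qed
  moreover have "x \<in> V"
    using V(2) W(2) \<open>x \<in> X\<close> by auto
  ultimately show ?thesis
    using V(1) \<open>x \<in> X\<close> unfolding Fbar_small_points_def by blast
qed

section \<open>Transitive points and the dichotomy\<close>

lemma transitive_point_enters_open:
  assumes "x \<in> transitive_points X T" "openin (top_of_set X) U" "U \<noteq> {}"
  obtains m where "(T ^^ m) x \<in> U"
proof -
  let ?O = "range (\<lambda>n. (T ^^ n) x)"
  have O: "?O \<subseteq> X" "X \<subseteq> closure ?O"
    using assms(1) by (auto simp: transitive_points_def dense_subset_def)
  obtain W where W: "open W" "U = X \<inter> W"
    using assms(2) by (auto simp: openin_open)
  have "W \<inter> closure ?O \<noteq> {}"
    using assms(3) W(2) O(2) by blast
  then have "W \<inter> ?O \<noteq> {}"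
    using open_Int_closure_eq_empty[OF W(1)] by blast
  then show thesis
    using that O(1) W(2) by blast
qed

lemma transitive_points_subset_Fbar_small_points:
  assumes "tds X T" "wme_points X T \<noteq> {}" "\<epsilon> > 0"
  shows "transitive_points X T \<subseteq> Fbar_small_points X T \<epsilon>"
proof
  fix x assume x: "x \<in> transitive_points X T"
  have "Fbar_small_points X T \<epsilon> \<noteq> {}"
    using wme_points_subset_Fbar_small_points[OF assms(3)] assms(2) by blast
  then obtain m where "(T ^^ m) x \<in> Fbar_small_points X T \<epsilon>"
    using transitive_point_enters_open[OF x openin_Fbar_small_points] by blast
  moreover have "x \<in> X"
    using x by (simp add: transitive_points_def)
  ultimately show "x \<in> Fbar_small_points X T \<epsilon>"
    using Fbar_small_points_backward[OF assms(1)] by blast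
qed

lemma transitive_points_subset_wme_points:
  assumes "tds X T" "wme_points X T \<noteq> {}"
  shows "transitive_points X T \<subseteq> wme_points X T"
proof -
  have "transitive_points X T \<subseteq> (\<Inter>n. Fbar_small_points X T (1 / real (Suc n)))"
    by (intro INT_greatest transitive_points_subset_Fbar_small_points[OF assms]) simp
  also have "\<dots> \<subseteq> wme_points X T"
    by (rule INT_Fbar_small_points_subset_wme_points)
  finally show ?thesis .
qed

lemma residual_wme_points:
  assumes "transitive_tds X T" "wme_points X T \<noteq> {}"
  shows "residual_subset X (wme_points X T)"
proof -
  let ?U = "\<lambda>n. Fbar_small_points X T (1 / real (Suc n))"
  have "dense_subset X (?U n)" for n
  proof -
    have "transitive_points X T \<subseteq> ?U n"
      using assms by (intro transitive_points_subset_Fbar_small_points) (auto simp: transitive_tds_def)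
    moreover have "X \<subseteq> closure (transitive_points X T)"
      using assms by (simp add: transitive_tds_def dense_subset_def)
    moreover have "?U n \<subseteq> X"
      by (auto simp: Fbar_small_points_def)
    ultimately show ?thesis
      unfolding dense_subset_def by (meson closure_mono order_trans)
  qed
  then have "\<forall>n. openin (top_of_set X) (?U n) \<and> dense_subset X (?U n)"
    using openin_Fbar_small_points by blast
  moreover have "wme_points X T \<subseteq> X"
    by (auto simp: wme_points_def)
  ultimately show ?thesis
    unfolding residual_subset_def
    using INT_Fbar_small_points_subset_wme_points[of X T] by (intro conjI exI[of _ ?U])
qed

lemma weakly_mean_equicontinuous_if_all_wme_points:
  assumes "tds X T" "X \<subseteq> wme_points X T"
  shows "weakly_mean_equicontinuous X T"
proof -
  have "\<exists>\<delta>>0. \<forall>x\<in>X. \<forall>y\<in>X. dist x y < \<delta> \<longrightarrow> Fbar T x y < ereal \<epsilon>" if "\<epsilon> > 0" for \<epsilon>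
  proof -
    let ?\<G> = "{W. open W \<and> (\<forall>y\<in>X \<inter> W. \<forall>z\<in>X \<inter> W. Fbar T y z < ereal \<epsilon>)}"
    have "X \<subseteq> Fbar_small_points X T \<epsilon>"
      using assms(2) wme_points_subset_Fbar_small_points[OF that] by blast
    then have "X \<subseteq> \<Union>?\<G>"
      unfolding Fbar_small_points_def by blast
    moreover have "compact X"
      using assms(1) by (simp add: tds_def)
    ultimately obtain \<delta> where \<delta>: "\<delta> > 0" "\<And>x. x \<in> X \<Longrightarrow> \<exists>W\<in>?\<G>. ball x \<delta> \<subseteq> W"
      using Heine_Borel_lemma[of X ?\<G>] by blast
    have "Fbar T x y < ereal \<epsilon>" if "x \<in> X" "y \<in> X" "dist x y < \<delta>" for x y
    proof -
      obtain W where "W \<in> ?\<G>" "ball x \<delta> \<subseteq> W"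
        using \<delta>(2)[OF \<open>x \<in> X\<close>] by blast
      moreover have "x \<in> ball x \<delta>" "y \<in> ball x \<delta>"
        using that(3) \<delta>(1) by auto
      ultimately show ?thesis
        using that(1,2) by blast
    qed
    with \<delta>(1) show ?thesis
      by blast
  qed
  with assms(1) show ?thesis
    by (simp add: weakly_mean_equicontinuous_def)
qed

theorem proposition4p2:
  fixes X :: "'a::metric_space set" and T :: "'a \<Rightarrow> 'a"
  assumes "transitive_tds X T"
  shows "(wme_points X T = {} \<or> residual_subset X (wme_points X T)) \<and>
         (almost_weakly_mean_equicontinuous X T \<longrightarrow>
            (\<forall>x\<in>transitive_points X T. x \<in> wme_points X T)) \<and>
         (minimal_tds X T \<and> almost_weakly_mean_equicontinuous X T \<longrightarrow>
            weakly_mean_equicontinuous X T)"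
proof (intro conjI impI)
  have tds: "tds X T"
    using assms by (simp add: transitive_tds_def)
  show "wme_points X T = {} \<or> residual_subset X (wme_points X T)"
    using residual_wme_points[OF assms] by blast
  show "\<forall>x\<in>transitive_points X T. x \<in> wme_points X T"
    if "almost_weakly_mean_equicontinuous X T"
    using transitive_points_subset_wme_points[OF tds] that
    by (auto simp: almost_weakly_mean_equicontinuous_def)
  show "weakly_mean_equicontinuous X T"
    if "minimal_tds X T \<and> almost_weakly_mean_equicontinuous X T"
  proof (rule weakly_mean_equicontinuous_if_all_wme_points[OF tds])
    have "X \<subseteq> transitive_points X T"
      using that by (auto simp: minimal_tds_def)
    also have "\<dots> \<subseteq> wme_points X T"
      using that by (intro transitive_points_subset_wme_points[OF tds])
        (simp add: almost_weakly_mean_equicontinuous_def)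
    finally show "X \<subseteq> wme_points X T" .
  qed
qed

end
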